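(* For every node subdomain $X_h\subseteq\mathcal{X}$, \[ \mathrm{LB}^{\mathrm{PALM}}(X_h)\le\min_{x\in X_h}\mu(x). \] That is, the PALM-Mean node problem $\mathrm{LB}^{\mathrm{PALM}}(X_h)=\min_{x\in X_h}\underline{\mu}_h^{\mathrm{PALM}}(x)$ defines a valid lower bound for spatial branch-and-bound.
   Context: Gaussian process posterior mean. Fixed training inputs $x_1,\ldots,x_N\in\mathbb{R}^D$, observations $y\in\mathbb{R}^N$, noise variance $\sigma_\epsilon^2$, lengthscale matrix $L=\mathrm{diag}(\ell_1,\ldots,\ell_D)$ with all $\ell_j>0$, and $\sigma_f^2>0$. Scaled distance: $r_i(x):=\|L^{-1}(x-x_i)\|_2$, $d_i(x):=r_i(x)^2$. The kernel is one of the following, with $k_i(x):=k(x,x_i)=\kappa(\zeta_i(x))$, where $\zeta_i(x):=d_i(x)$ for RBF and $\zeta_i(x):=r_i(x)$ for Matérn: - RBF: $\kappa(d)=\sigma_f^2e^{-d/2}$; - Matérn-$1/2$: $\kappa(r)=\sigma_f^2e^{-r}$; - Matérn-$3/2$: $\kappa(r)=\sigma_f^2(1+\sqrt3\,r)e^{-\sqrt3 r}$; - Matérn-$5/2$: $\kappa(r)=\sigma_f^2(1+\sqrt5\,r+\tfrac53r^2)e^{-\sqrt5 r}$. The posterior mean is $\mu(x)=\sum_{i=1}^N\alpha_ik_i(x)$ with $\alpha=(K_{XX}+\sigma_\epsilon^2I)^{-1}y\in\mathbb{R}^N$, $K_{XX}=[k(x_i,x_j)]_{i,j}$ (the inverse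 is assumed to exist). Put $\alpha_i^+:=\max\{0,\alpha_i\}$, $\alpha_i^-:=\max\{0,-\alpha_i\}$. The domain is a hyperrectangle $\mathcal{X}=[x^L,x^U]\subset\mathbb{R}^D$ with $x^L<x^U$ componentwise; nodes $X_h=[x_h^L,x_h^U]\subseteq\mathcal{X}$ are again hyperrectangles with $x_h^L<x_h^U$ componentwise. Analytical bounds. For a node $X_h$, let $\Delta^{\mathrm{near}}_{i,h,j}$ be the distance from $x_{i,j}$ to the interval $[x_{h,j}^L,x_{h,j}^U]$, and $\Delta^{\mathrm{far}}_{i,h,j}:=\max\{|x_{h,j}^L-x_{i,j}|,|x_{h,j}^U-x_{i,j}|\}$. Set $r_{i,h}^L=\big(\sum_j(\Delta^{\mathrm{near}}_{i,h,j})^2/\ell_j^2\big)^{1/2}$, $r_{i,h}^U=\big(\sum_j(\Delta^{\mathrm{far}}_{i,h,j})^2/\ell_j^2\big)^{1/2}$. Let $[\zeta_{i,h}^L,\zeta_{i,h}^U]$ be $[(r_{i,h}^L)^2,(r_{i,h}^U)^2]$ for RBF and $[r_{i,h}^L,r_{i,h}^U]$ for Matérn. Define $\underline{k}_{i,h}^{A}:=\kappa(\zeta_{i,h}^U)$, $\overline{k}_{i,h}^{A}:=\kappa(\zeta_{i,h}^L)$ and $\underline{t}_{i,h}^{A}:=\alpha_i^+\underline{k}_{i,h}^{A}-\alpha_i^-\overline{k}_{i,h}^{A}$. Important/unimportant terms. With $\beta_{i,h}:=\max_{x\in X_h}|\alpha_ik_i(x)|$ and a threshold $\rho\in[0,1]$,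 $\mathcal{I}(h):=\{i:\beta_{i,h}\ge\rho\}$ and $\mathcal{U}(h):=\{1,\ldots,N\}\setminus\mathcal{I}(h)$. Piecewise-linear envelopes. For each $i\in\mathcal{I}(h)$ choose breakpoints $\zeta_{i,h}^L=\eta_{i,0}<\eta_{i,1}<\cdots<\eta_{i,S_i}=\zeta_{i,h}^U$. For Matérn-$3/2$ and Matérn-$5/2$ the inflection point of $\kappa$ ($1/\sqrt3$ and $(1+\sqrt5)/(2\sqrt5)$, respectively) must be one of the breakpoints whenever it lies in the interior of $[\zeta_{i,h}^L,\zeta_{i,h}^U]$; $\kappa$ is concave on $[0,\text{inflection point}]$ and convex beyond it. For RBF and Matérn-$1/2$, $\kappa$ is convex on $[0,\infty)$. On a segment $[\eta_{i,s-1},\eta_{i,s}]$ let $u_{i,s}$ be the secant line (the affine function agreeing with $\kappa$ at both endpoints) and let the tangent envelope be $\ell_{i,s}(\zeta):=\max\{\kappa(\eta_{i,s-1})+\kappa'(\eta_{i,s-1})(\zeta-\eta_{i,s-1}),\ \kappa(\eta_{i,s})+\kappa'(\eta_{i,s})(\zeta-\eta_{i,s})\}$. (Derivatives at $0$ are one-sided, given by the formula for $\kappa'$.) On a segment where $\kappa$ is convex, the lower envelope is $\underline{\kappa}^P_{i,s}:=\ell_{i,s}$ and the upper envelope is $\overline{\kappa}^P_{i,s}:=u_{i,s}$; on a segment where $\kappa$ is concave, $\underline{\kappa}^P_{i,s}:=u_{i,s}$ and $\overline{\kappa}^P_{i,s}:=\ell_{i,s}$. Then for $x\in X_h$, $\underline{k}_{i,h}^{P}(x):=\underline{\kappa}^P_{i,s}(\zeta_i(x))$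 and $\overline{k}_{i,h}^{P}(x):=\overline{\kappa}^P_{i,s}(\zeta_i(x))$, where $s$ is the segment containing $\zeta_i(x)$; if $\zeta_i(x)$ is a breakpoint shared by two segments, the lower envelope takes the smaller and the upper envelope the larger of the two values. PALM-Mean lower estimator and node bound: \[ \underline{\mu}_h^{\mathrm{PALM}}(x):=\sum_{i\in\mathcal{I}(h)}\left(\alpha_i^+\underline{k}_{i,h}^{P}(x)-\alpha_i^-\overline{k}_{i,h}^{P}(x)\right)+\sum_{i\in\mathcal{U}(h)}\underline{t}_{i,h}^{A},\qquad \mathrm{LB}^{\mathrm{PALM}}(X_h):=\min_{x\in X_h}\underline{\mu}_h^{\mathrm{PALM}}(x). \] A valid lower bound on a node is a scalar $\mathrm{LB}(X_h)$ with $\mathrm{LB}(X_h)\le\min_{x\in X_h}\mu(x)$. *)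

theory Defs
  imports "HOL-Analysis.Analysis"
begin

datatype kernel = RBF | Matern12 | Matern32 | Matern52

text \<open>
  The profile is given by its closed formula on all of \<open>\<real>\<close>, although only arguments
  \<open>z \<ge> 0\<close> matter. Hence \<open>deriv (kappa K s) 0\<close> is the value at \<open>0\<close> of the formula for the
  derivative, that is, the one-sided derivative of the profile on \<open>[0, \<infinity>)\<close>.
\<close>

fun kappa :: "kernel \<Rightarrow> real \<Rightarrow> real \<Rightarrow> real" where
  "kappa RBF s d = s^2 * exp (- d / 2)"
| "kappa Matern12 s r = s^2 * exp (- r)"
| "kappa Matern32 s r = s^2 * (1 + sqrt 3 * r) * exp (- (sqrt 3 * r))"
| "kappa Matern52 s r = s^2 * (1 + sqrt 5 * r + 5 / 3 * r^2) * exp (- (sqrt 5 * r))"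

fun inflection_points :: "kernel \<Rightarrow> real set" where
  "inflection_points RBF = {}"
| "inflection_points Matern12 = {}"
| "inflection_points Matern32 = {1 / sqrt 3}"
| "inflection_points Matern52 = {(1 + sqrt 5) / (2 * sqrt 5)}"

text \<open>The argument of the profile belonging to a scaled distance \<open>r\<close>.\<close>

definition profile_arg :: "kernel \<Rightarrow> real \<Rightarrow> real" where
  "profile_arg K r = (if K = RBF then r^2 else r)"

record ('d, 'n) gp =
  kern :: kernel
  sigma_f :: real
  sigma_eps :: real
  ell :: "real ^ 'd"
  inputs :: "'n \<Rightarrow> real ^ 'd"
  obs :: "real ^ 'n"

definition diag_matrix :: "real ^ 'd \<Rightarrow> real ^ 'd ^ 'd" where
  "diag_matrix v = (\<chi> i j. if i = j then v $ i else 0)"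

definition scaled_dist :: "real ^ 'd::finite \<Rightarrow> real ^ 'd \<Rightarrow> real ^ 'd \<Rightarrow> real" where
  "scaled_dist l x x' = norm (matrix_inv (diag_matrix l) *v (x - x'))"

definition zeta :: "('d::finite, 'n::finite) gp \<Rightarrow> 'n \<Rightarrow> real ^ 'd \<Rightarrow> real" where
  "zeta G i x = profile_arg (kern G) (scaled_dist (ell G) x (inputs G i))"

abbreviation prof :: "('d::finite, 'n::finite) gp \<Rightarrow> real \<Rightarrow> real" where
  "prof G \<equiv> kappa (kern G) (sigma_f G)"

definition k_at :: "('d::finite, 'n::finite) gp \<Rightarrow> 'n \<Rightarrow> real ^ 'd \<Rightarrow> real" where
  "k_at G i x = prof G (zeta G i x)"

definition gram :: "('d::finite, 'n::finite) gp \<Rightarrow> real ^ 'n ^ 'n" where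
  "gram G = (\<chi> i j. k_at G j (inputs G i))"

definition noisy_gram :: "('d::finite, 'n::finite) gp \<Rightarrow> real ^ 'n ^ 'n" where
  "noisy_gram G = gram G + (sigma_eps G)^2 *\<^sub>R mat 1"

definition alpha :: "('d::finite, 'n::finite) gp \<Rightarrow> real ^ 'n" where
  "alpha G = matrix_inv (noisy_gram G) *v obs G"

definition alpha_pos :: "('d::finite, 'n::finite) gp \<Rightarrow> 'n \<Rightarrow> real" where
  "alpha_pos G i = max 0 (alpha G $ i)"

definition alpha_neg :: "('d::finite, 'n::finite) gp \<Rightarrow> 'n \<Rightarrow> real" where
  "alpha_neg G i = max 0 (- (alpha G $ i))"

definition posterior_mean :: "('d::finite, 'n::finite) gp \<Rightarrow> real ^ 'd \<Rightarrow> real" where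
  "posterior_mean G x = (\<Sum>i\<in>UNIV. alpha G $ i * k_at G i x)"

definition valid_gp :: "('d::finite, 'n::finite) gp \<Rightarrow> bool" where
  "valid_gp G \<longleftrightarrow>
     (sigma_f G)^2 > 0 \<and> (\<forall>j. ell G $ j > 0) \<and> invertible (noisy_gram G)"

text \<open>In what follows a node is the box \<open>cbox a b\<close> and is passed as its two corners.\<close>

definition delta_near :: "('d::finite, 'n::finite) gp \<Rightarrow> real ^ 'd \<Rightarrow> real ^ 'd \<Rightarrow> 'n \<Rightarrow> 'd \<Rightarrow> real" where
  "delta_near G a b i j = infdist (inputs G i $ j) {a $ j..b $ j}"

definition delta_far :: "('d::finite, 'n::finite) gp \<Rightarrow> real ^ 'd \<Rightarrow> real ^ 'd \<Rightarrow> 'n \<Rightarrow> 'd \<Rightarrow> real" where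
  "delta_far G a b i j = max \<bar>a $ j - inputs G i $ j\<bar> \<bar>b $ j - inputs G i $ j\<bar>"

definition zeta_lo :: "('d::finite, 'n::finite) gp \<Rightarrow> real ^ 'd \<Rightarrow> real ^ 'd \<Rightarrow> 'n \<Rightarrow> real" where
  "zeta_lo G a b i =
     profile_arg (kern G) (sqrt (\<Sum>j\<in>UNIV. (delta_near G a b i j)^2 / (ell G $ j)^2))"

definition zeta_up :: "('d::finite, 'n::finite) gp \<Rightarrow> real ^ 'd \<Rightarrow> real ^ 'd \<Rightarrow> 'n \<Rightarrow> real" where
  "zeta_up G a b i =
     profile_arg (kern G) (sqrt (\<Sum>j\<in>UNIV. (delta_far G a b i j)^2 / (ell G $ j)^2))"

definition analytic_term :: "('d::finite, 'n::finite) gp \<Rightarrow> real ^ 'd \<Rightarrow> real ^ 'd \<Rightarrow> 'n \<Rightarrow> real" where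
  "analytic_term G a b i =
     alpha_pos G i * prof G (zeta_up G a b i) - alpha_neg G i * prof G (zeta_lo G a b i)"

text \<open>The supremum is a maximum, as the function is continuous and the box compact.\<close>

definition beta :: "('d::finite, 'n::finite) gp \<Rightarrow> real ^ 'd \<Rightarrow> real ^ 'd \<Rightarrow> 'n \<Rightarrow> real" where
  "beta G a b i = (SUP x\<in>cbox a b. \<bar>alpha G $ i * k_at G i x\<bar>)"

definition important ::
    "('d::finite, 'n::finite) gp \<Rightarrow> real \<Rightarrow> real ^ 'd \<Rightarrow> real ^ 'd \<Rightarrow> 'n set" where
  "important G \<rho> a b = {i. beta G a b i \<ge> \<rho>}"

definition unimportant ::
    "('d::finite, 'n::finite) gp \<Rightarrow> real \<Rightarrow> real ^ 'd \<Rightarrow> real ^ 'd \<Rightarrow> 'n set" where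
  "unimportant G \<rho> a b = UNIV - important G \<rho> a b"

text \<open>Breakpoints \<open>\<eta> 0 < \<dots> < \<eta> S\<close>; segment \<open>s \<in> {1..S}\<close> is \<open>{\<eta> (s - 1)..\<eta> s}\<close>.\<close>

definition admissible_breakpoints ::
    "('d::finite, 'n::finite) gp \<Rightarrow> real ^ 'd \<Rightarrow> real ^ 'd \<Rightarrow> 'n \<Rightarrow> nat \<Rightarrow> (nat \<Rightarrow> real) \<Rightarrow> bool" where
  "admissible_breakpoints G a b i S \<eta> \<longleftrightarrow>
     \<eta> 0 = zeta_lo G a b i \<and> \<eta> S = zeta_up G a b i \<and> strict_mono_on {0..S} \<eta> \<and>
     inflection_points (kern G) \<inter> {zeta_lo G a b i<..<zeta_up G a b i} \<subseteq> \<eta> ` {0..S}"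

definition secant :: "(real \<Rightarrow> real) \<Rightarrow> real \<Rightarrow> real \<Rightarrow> real \<Rightarrow> real" where
  "secant f p q z = f p + (f q - f p) / (q - p) * (z - p)"

definition tangent_env :: "(real \<Rightarrow> real) \<Rightarrow> real \<Rightarrow> real \<Rightarrow> real \<Rightarrow> real" where
  "tangent_env f p q z = max (f p + deriv f p * (z - p)) (f q + deriv f q * (z - q))"

text \<open>
  For admissible breakpoints the profile is convex or concave on each segment, and never
  both, so that the alternative to convexity below is concavity.
\<close>

definition seg_lower :: "(real \<Rightarrow> real) \<Rightarrow> real \<Rightarrow> real \<Rightarrow> real \<Rightarrow> real" where
  "seg_lower f p q = (if convex_on {p..q} f then tangent_env f p q else secant f p q)"

definition seg_upper :: "(real \<Rightarrow> real) \<Rightarrow> real \<Rightarrow> real \<Rightarrow> real \<Rightarrow> real" where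
  "seg_upper f p q = (if convex_on {p..q} f then secant f p q else tangent_env f p q)"

definition segs :: "nat \<Rightarrow> (nat \<Rightarrow> real) \<Rightarrow> real \<Rightarrow> nat set" where
  "segs S \<eta> z = {s \<in> {1..S}. \<eta> (s - 1) \<le> z \<and> z \<le> \<eta> s}"

text \<open>
  The set \<open>segs S \<eta> z\<close> has two elements exactly if \<open>z\<close> is a breakpoint shared by two segments.
\<close>

definition pw_lower ::
    "('d::finite, 'n::finite) gp \<Rightarrow> ('n \<Rightarrow> nat) \<Rightarrow> ('n \<Rightarrow> nat \<Rightarrow> real) \<Rightarrow> 'n \<Rightarrow> real ^ 'd \<Rightarrow> real" where
  "pw_lower G S \<eta> i x =
     Min ((\<lambda>s. seg_lower (prof G) (\<eta> i (s - 1)) (\<eta> i s) (zeta G i x)) ` segs (S i) (\<eta> i) (zeta G i x))"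

definition pw_upper ::
    "('d::finite, 'n::finite) gp \<Rightarrow> ('n \<Rightarrow> nat) \<Rightarrow> ('n \<Rightarrow> nat \<Rightarrow> real) \<Rightarrow> 'n \<Rightarrow> real ^ 'd \<Rightarrow> real" where
  "pw_upper G S \<eta> i x =
     Max ((\<lambda>s. seg_upper (prof G) (\<eta> i (s - 1)) (\<eta> i s) (zeta G i x)) ` segs (S i) (\<eta> i) (zeta G i x))"

definition palm_mean ::
    "('d::finite, 'n::finite) gp \<Rightarrow> real \<Rightarrow> ('n \<Rightarrow> nat) \<Rightarrow> ('n \<Rightarrow> nat \<Rightarrow> real) \<Rightarrow>
     real ^ 'd \<Rightarrow> real ^ 'd \<Rightarrow> real ^ 'd \<Rightarrow> real" where
  "palm_mean G \<rho> S \<eta> a b x =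
     (\<Sum>i\<in>important G \<rho> a b. alpha_pos G i * pw_lower G S \<eta> i x - alpha_neg G i * pw_upper G S \<eta> i x) +
     (\<Sum>i\<in>unimportant G \<rho> a b. analytic_term G a b i)"

text \<open>
  Minima over a box are written as infima; \<open>attains_min\<close> says that such an infimum is a minimum.
\<close>

definition attains_min :: "('a \<Rightarrow> real) \<Rightarrow> 'a set \<Rightarrow> bool" where
  "attains_min f X \<longleftrightarrow> (\<exists>x\<in>X. \<forall>y\<in>X. f x \<le> f y)"

definition palm_lb ::
    "('d::finite, 'n::finite) gp \<Rightarrow> real \<Rightarrow> ('n \<Rightarrow> nat) \<Rightarrow> ('n \<Rightarrow> nat \<Rightarrow> real) \<Rightarrow>
     real ^ 'd \<Rightarrow> real ^ 'd \<Rightarrow> real" where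
  "palm_lb G \<rho> S \<eta> a b = (INF x\<in>cbox a b. palm_mean G \<rho> S \<eta> a b x)"

definition valid_lower_bound ::
    "('d::finite, 'n::finite) gp \<Rightarrow> real ^ 'd \<Rightarrow> real ^ 'd \<Rightarrow> real \<Rightarrow> bool" where
  "valid_lower_bound G a b lb \<longleftrightarrow> lb \<le> (INF x\<in>cbox a b. posterior_mean G x)"

end

theory Submission
  imports Defs
begin

text \<open>
  On each segment the profile is convex or concave, so its secant and its tangents enclose it, and
  the profile decreases, so the distance bounds enclose it too; weighting by \<open>\<alpha>\<^sup>+\<close> and \<open>\<alpha>\<^sup>-\<close>
  gives an underestimator of the mean on the whole box. At shared breakpoints the tangent envelopes
  of a concave profile jump, so the estimator need not be continuous; the choice of the smaller
  lower value and the larger upper value makes it lower semicontinuous, which is enough for the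
  minimum to be attained.
\<close>

subsection \<open>Lower semicontinuity\<close>

text \<open>Epsilon form of lower semicontinuity relative to \<open>X\<close>. The punctured filter
  loses nothing, since \<open>f x - e < f x\<close> holds at \<open>x\<close> itself.\<close>

definition lsc_on :: "'a::topological_space set \<Rightarrow> ('a \<Rightarrow> real) \<Rightarrow> bool" where
  "lsc_on X f \<longleftrightarrow> (\<forall>x\<in>X. \<forall>e>0. eventually (\<lambda>y. f x - e < f y) (at x within X))"

lemma lsc_on_cong:
  assumes "\<And>x. x \<in> X \<Longrightarrow> f x = g x"
  shows "lsc_on X f \<longleftrightarrow> lsc_on X g"
proof -
  have "eventually (\<lambda>y. f x - e < f y) (at x within X)
      \<longleftrightarrow> eventually (\<lambda>y. g x - e < g y) (at x within X)" if "x \<in> X" for x e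
    using that assms by (auto simp: eventually_at_filter elim!: eventually_mono)
  then show ?thesis
    by (simp add: lsc_on_def)
qed

lemma continuous_on_imp_lsc_on:
  assumes "continuous_on X f"
  shows "lsc_on X f"
  unfolding lsc_on_def
proof (intro ballI allI impI)
  fix x and e :: real
  assume "x \<in> X" "e > 0"
  then show "eventually (\<lambda>y. f x - e < f y) (at x within X)"
    using assms by (intro order_tendstoD(1)[of f "f x"]) (auto simp: continuous_on_def)
qed

lemma lsc_on_add:
  assumes "lsc_on X f" "lsc_on X g"
  shows "lsc_on X (\<lambda>x. f x + g x)"
  unfolding lsc_on_def
proof (intro ballI allI impI)
  fix x and e :: real
  assume x: "x \<in> X" and "e > 0"
  then have e: "e / 2 > 0"
    by simp
  have "eventually (\<lambda>y. f x - e / 2 < f y) (at x within X)"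
      "eventually (\<lambda>y. g x - e / 2 < g y) (at x within X)"
    using assms x e unfolding lsc_on_def by simp_all
  then show "eventually (\<lambda>y. f x + g x - e < f y + g y) (at x within X)"
    by eventually_elim linarith
qed

lemma lsc_on_sum:
  assumes "\<And>i. i \<in> I \<Longrightarrow> lsc_on X (f i)"
  shows "lsc_on X (\<lambda>x. \<Sum>i\<in>I. f i x)"
  using assms
  by (induction I rule: infinite_finite_induct)
    (auto intro: continuous_on_imp_lsc_on lsc_on_add)

lemma lsc_on_cmult:
  assumes "lsc_on X f" "0 \<le> c"
  shows "lsc_on X (\<lambda>x. c * f x)"
proof (cases "c = 0")
  case True
  then show ?thesis
    by (simp add: continuous_on_imp_lsc_on)
next
  case False
  with assms have c: "c > 0"
    by simp
  show ?thesis
    unfolding lsc_on_def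
  proof (intro ballI allI impI)
    fix x and e :: real
    assume x: "x \<in> X" and "e > 0"
    then have "e / c > 0"
      using c by simp
    then have "eventually (\<lambda>y. f x - e / c < f y) (at x within X)"
      using assms x unfolding lsc_on_def by blast
    then show "eventually (\<lambda>y. c * f x - e < c * f y) (at x within X)"
      by (rule eventually_mono) (use c in \<open>auto simp: field_simps\<close>)
  qed
qed

text \<open>Pieces inactive at \<open>x\<close> stay inactive nearby because each \<open>C s\<close>
  is closed. Hence near \<open>x\<close> the minimum runs over some of the pieces active at
  \<open>x\<close>, and dropping pieces can only raise it; this may break continuity but not lower
  semicontinuity. The covering hypothesis keeps \<open>Min\<close> away from the empty set, where
  its value is unspecified.\<close>

lemma lsc_on_Min:
  assumes "finite I" and cl: "\<And>s. s \<in> I \<Longrightarrow> closed (C s)"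
    and cont: "\<And>s. s \<in> I \<Longrightarrow> continuous_on X (g s)"
    and ne: "\<And>x. x \<in> X \<Longrightarrow> \<exists>s\<in>I. x \<in> C s"
  shows "lsc_on X (\<lambda>x. Min ((\<lambda>s. g s x) ` {s \<in> I. x \<in> C s}))"
  unfolding lsc_on_def
proof (intro ballI allI impI)
  fix x and e :: real
  assume x: "x \<in> X" and e: "e > 0"
  let ?M = "\<lambda>x. Min ((\<lambda>s. g s x) ` {s \<in> I. x \<in> C s})"
  have "eventually (\<lambda>y. y \<in> C s \<longrightarrow> ?M x - e < g s y) (at x within X)" if s: "s \<in> I" for s
  proof (cases "x \<in> C s")
    case True
    then have "?M x \<le> g s x"
      using \<open>finite I\<close> s by (intro Min_le) auto
    moreover have "eventually (\<lambda>y. g s x - e < g s y) (at x within X)"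
      using continuous_on_imp_lsc_on[OF cont[OF s]] x e unfolding lsc_on_def by blast
    ultimately show ?thesis
      by (auto elim!: eventually_mono)
  next
    case False
    then have "eventually (\<lambda>y. y \<in> - C s) (at x within X)"
      using cl[OF s] by (intro topological_tendstoD[OF tendsto_ident_at]) auto
    then show ?thesis
      by (auto elim!: eventually_mono)
  qed
  then have "eventually (\<lambda>y. \<forall>s\<in>I. y \<in> C s \<longrightarrow> ?M x - e < g s y) (at x within X)"
    using \<open>finite I\<close> by (intro eventually_ball_finite) auto
  moreover have "eventually (\<lambda>y. y \<in> X) (at x within X)"
    by (auto simp: eventually_at_filter)
  ultimately show "eventually (\<lambda>y. ?M x - e < ?M y) (at x within X)"
  proof eventually_elim
    case (elim y)
    then show ?case
      using \<open>finite I\<close> ne[of y] by (subst Min_gr_iff) auto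
  qed
qed

text \<open>Without a minimum every \<open>x\<close> has a strictly better point \<open>m x\<close>,
  and \<open>f\<close> stays above \<open>f (m x)\<close> on a neighbourhood of \<open>x\<close>.
  Among the centres of a finite subcover choose the one with least \<open>f (m x)\<close>: the point
  \<open>m x\<close> lies in the neighbourhood of some centre \<open>z\<close>, so
  \<open>f (m z) < f (m x)\<close>, a contradiction.\<close>

lemma lsc_on_attains_min:
  assumes "compact X" "X \<noteq> {}" "lsc_on X f"
  shows "attains_min f X"
proof (rule ccontr)
  assume "\<not> attains_min f X"
  then have "\<forall>x\<in>X. \<exists>y\<in>X. f y < f x"
    by (auto simp: attains_min_def not_le)
  then obtain m where m: "\<And>x. x \<in> X \<Longrightarrow> m x \<in> X \<and> f (m x) < f x"
    by metis
  have "\<exists>U. open U \<and> x \<in> U \<and> (\<forall>y\<in>U \<inter> X. f (m x) < f y)" if x: "x \<in> X" for x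
  proof -
    \<comment> \<open>The tolerance is the gap \<open>f x - f (m x)\<close>, which makes
      \<open>f (m x)\<close> itself the lower bound on the neighbourhood.\<close>
    have "eventually (\<lambda>y. f x - (f x - f (m x)) < f y) (at x within X)"
      using assms(3) x m[OF x] unfolding lsc_on_def by (metis diff_gt_0_iff_gt)
    then obtain U where "open U" "x \<in> U" "\<forall>y\<in>U. y \<noteq> x \<longrightarrow> y \<in> X \<longrightarrow> f (m x) < f y"
      by (auto simp: eventually_at_topological)
    then show ?thesis
      using m[OF x] by (metis IntD1 IntD2)
  qed
  then obtain U where U: "\<And>x. x \<in> X \<Longrightarrow> open (U x) \<and> x \<in> U x \<and> (\<forall>y\<in>U x \<inter> X. f (m x) < f y)"
    by metis
  then obtain F where F: "F \<subseteq> X" "finite F" "X \<subseteq> (\<Union>x\<in>F. U x)"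
    by (auto intro: compactE_image[OF assms(1), of X U])
  with assms(2) have "F \<noteq> {}"
    by auto
  then obtain x where x: "x \<in> F" "\<And>z. z \<in> F \<Longrightarrow> f (m x) \<le> f (m z)"
    using ex_min_if_finite[of "(\<lambda>z. f (m z)) ` F"] F(2) by (auto simp: not_less)
  then have "m x \<in> X"
    using F(1) m by blast
  then obtain z where z: "z \<in> F" "m x \<in> U z"
    using F(3) by blast
  then have "f (m z) < f (m x)"
    using U F(1) \<open>m x \<in> X\<close> by blast
  with x(2)[OF z(1)] show False
    by simp
qed

subsection \<open>Secant and tangent bounds\<close>

text \<open>Parametrize the segment from \<open>c\<close> to \<open>z\<close> by \<open>t\<close>.
  Convexity bounds the difference quotients at \<open>t = 0\<close> by \<open>f z - f c\<close>, and
  their limit from the right is \<open>D * (z - c)\<close>. This treats \<open>z\<close> on either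
  side of \<open>c\<close>, and \<open>c\<close> at an end of \<open>A\<close>, alike.\<close>

lemma convex_on_above_tangent:
  fixes f :: "real \<Rightarrow> real"
  assumes "convex_on A f" "c \<in> A" "z \<in> A" "(f has_real_derivative D) (at c)"
  shows "f c + D * (z - c) \<le> f z"
proof -
  define g where "g t = f (c + t * (z - c))" for t
  have "(g has_real_derivative D * (z - c)) (at 0)"
    unfolding g_def using assms(4) by (auto intro!: derivative_eq_intros DERIV_chain2[of f])
  then have "(g has_real_derivative D * (z - c)) (at_right 0)"
    by (rule has_field_derivative_at_within)
  then have "((\<lambda>t. (g t - g 0) / t) \<longlongrightarrow> D * (z - c)) (at_right 0)"
    by (simp add: has_field_derivative_iff)
  moreover have "(g t - g 0) / t \<le> f z - f c" if "0 < t" "t < 1" for t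
  proof -
    have "g t \<le> (1 - t) * f c + t * f z"
      using convex_onD[OF assms(1), of t c z] that assms(2,3)
      by (simp add: g_def algebra_simps)
    then show ?thesis
      using that by (simp add: g_def field_simps)
  qed
  then have "eventually (\<lambda>t. (g t - g 0) / t \<le> f z - f c) (at_right 0)"
    by (auto simp: eventually_at_right_field intro!: exI[of _ 1])
  ultimately have "D * (z - c) \<le> f z - f c"
    by (intro tendsto_upperbound) auto
  then show ?thesis
    by simp
qed

lemma concave_on_below_tangent:
  fixes f :: "real \<Rightarrow> real"
  assumes "concave_on A f" "c \<in> A" "z \<in> A" "(f has_real_derivative D) (at c)"
  shows "f z \<le> f c + D * (z - c)"
  using convex_on_above_tangent[of A "\<lambda>x. - f x" c z "- D"] assms DERIV_minus[OF assms(4)]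
  by (auto simp: concave_on_def)

lemma seg_bounds:
  assumes "convex_on {p..q} f \<or> concave_on {p..q} f" "z \<in> {p..q}"
    and diff: "\<And>x. f field_differentiable at x"
  shows "seg_lower f p q z \<le> f z" "f z \<le> seg_upper f p q z"
proof -
  have D: "(f has_real_derivative deriv f x) (at x)" for x
    using diff DERIV_deriv_iff_field_differentiable by blast
  have pq: "p \<in> {p..q}" "q \<in> {p..q}"
    using assms(2) by auto
  \<comment> \<open>The envelopes test convexity first, so a function that is both convex and
    concave on the segment belongs to the first case.\<close>
  consider "convex_on {p..q} f" | "\<not> convex_on {p..q} f" "concave_on {p..q} f"
    using assms(1) by blast
  then have "seg_lower f p q z \<le> f z \<and> f z \<le> seg_upper f p q z"
  proof cases
    case 1
    then show ?thesis
      using convex_on_above_tangent[OF 1 pq(1) assms(2) D]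
        convex_on_above_tangent[OF 1 pq(2) assms(2) D] convex_onD_Icc'[OF 1 assms(2)]
      by (simp add: seg_lower_def seg_upper_def tangent_env_def secant_def)
  next
    case 2
    then show ?thesis
      \<comment> \<open>The upper envelope is the maximum of two tangents, so one tangent above
        \<open>f\<close> suffices; the one at \<open>p\<close> is taken.\<close>
      using concave_on_below_tangent[OF 2(2) pq(1) assms(2) D]
        concave_onD_Icc'[OF 2(2) assms(2)]
      by (auto simp: seg_lower_def seg_upper_def tangent_env_def secant_def)
  qed
  then show "seg_lower f p q z \<le> f z" "f z \<le> seg_upper f p q z"
    by auto
qed

lemma continuous_on_secant: "continuous_on X (secant f p q)"
proof -
  have "continuous_on X (\<lambda>z. f p + c * (z - p))" for c
    by (intro continuous_intros)
  then show ?thesis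
    unfolding secant_def[abs_def] .
qed

lemma continuous_on_tangent_env: "continuous_on X (tangent_env f p q)"
  unfolding tangent_env_def[abs_def] by (intro continuous_intros)

lemma continuous_on_seg_lower: "continuous_on X (seg_lower f p q)"
  by (simp add: seg_lower_def continuous_on_secant continuous_on_tangent_env)

lemma continuous_on_seg_upper: "continuous_on X (seg_upper f p q)"
  by (simp add: seg_upper_def continuous_on_secant continuous_on_tangent_env)

subsection \<open>The profiles\<close>

fun kappa_deriv :: "kernel \<Rightarrow> real \<Rightarrow> real \<Rightarrow> real" where
  "kappa_deriv RBF s d = - (s^2 / 2) * exp (- d / 2)"
| "kappa_deriv Matern12 s r = - (s^2) * exp (- r)"
| "kappa_deriv Matern32 s r = - 3 * s^2 * r * exp (- (sqrt 3 * r))"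
| "kappa_deriv Matern52 s r = - (5 / 3) * s^2 * (r + sqrt 5 * r^2) * exp (- (sqrt 5 * r))"

text \<open>The exponential is factored out, so the sign is that of a polynomial. For Matern-5/2 it
  is \<open>t^2 - t - 1\<close> in \<open>t = sqrt 5 * r\<close>.\<close>

fun kappa_deriv2 :: "kernel \<Rightarrow> real \<Rightarrow> real \<Rightarrow> real" where
  "kappa_deriv2 RBF s d = s^2 / 4 * exp (- d / 2)"
| "kappa_deriv2 Matern12 s r = s^2 * exp (- r)"
| "kappa_deriv2 Matern32 s r = 3 * s^2 * (sqrt 3 * r - 1) * exp (- (sqrt 3 * r))"
| "kappa_deriv2 Matern52 s r =
     5 / 3 * s^2 * ((sqrt 5 * r)^2 - sqrt 5 * r - 1) * exp (- (sqrt 5 * r))"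

lemma sqrt_mult_sqrt_left: "0 \<le> c \<Longrightarrow> sqrt c * (sqrt c * x) = c * x"
  by (simp flip: mult.assoc)

text \<open>The formulas extend to the whole line, so the derivative is two-sided even at 0, where a
  segment may begin; this supplies the differentiability that the tangent bounds require.\<close>

lemma DERIV_kappa: "(kappa K s has_real_derivative kappa_deriv K s x) (at x)"
proof (cases K)
  case RBF
  have "((\<lambda>d. s^2 * exp (- d / 2)) has_real_derivative kappa_deriv K s x) (at x)"
    unfolding RBF by (auto intro!: derivative_eq_intros)
  with RBF show ?thesis
    by (simp add: kappa.simps[abs_def])
next
  case Matern12
  have "((\<lambda>r. s^2 * exp (- r)) has_real_derivative kappa_deriv K s x) (at x)"
    unfolding Matern12 by (auto intro!: derivative_eq_intros)
  with Matern12 show ?thesis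
    by (simp add: kappa.simps[abs_def])
next
  case Matern32
  have "((\<lambda>r. s^2 * (1 + sqrt 3 * r) * exp (- (sqrt 3 * r))) has_real_derivative
      kappa_deriv K s x) (at x)"
    unfolding Matern32
    by (auto intro!: derivative_eq_intros simp: algebra_simps sqrt_mult_sqrt_left)
  with Matern32 show ?thesis
    by (simp add: kappa.simps[abs_def])
next
  case Matern52
  have "((\<lambda>r. s^2 * (1 + sqrt 5 * r + 5 / 3 * r^2) * exp (- (sqrt 5 * r))) has_real_derivative
      kappa_deriv K s x) (at x)"
    unfolding Matern52
    by (auto intro!: derivative_eq_intros simp: field_simps sqrt_mult_sqrt_left power2_eq_square)
  with Matern52 show ?thesis
    by (simp add: kappa.simps[abs_def])
qed

lemma DERIV_kappa_deriv: "(kappa_deriv K s has_real_derivative kappa_deriv2 K s x) (at x)"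
proof (cases K)
  case RBF
  have "((\<lambda>d. - (s^2 / 2) * exp (- d / 2)) has_real_derivative kappa_deriv2 K s x) (at x)"
    unfolding RBF by (auto intro!: derivative_eq_intros)
  with RBF show ?thesis
    by (simp add: kappa_deriv.simps[abs_def])
next
  case Matern12
  have "((\<lambda>r. - (s^2) * exp (- r)) has_real_derivative kappa_deriv2 K s x) (at x)"
    unfolding Matern12 by (auto intro!: derivative_eq_intros)
  with Matern12 show ?thesis
    by (simp add: kappa_deriv.simps[abs_def])
next
  case Matern32
  have "((\<lambda>r. - 3 * s^2 * r * exp (- (sqrt 3 * r))) has_real_derivative
      kappa_deriv2 K s x) (at x)"
    unfolding Matern32 by (auto intro!: derivative_eq_intros simp: algebra_simps)
  with Matern32 show ?thesis
    by (simp add: kappa_deriv.simps[abs_def])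
next
  case Matern52
  have "((\<lambda>r. - (5 / 3) * s^2 * (r + sqrt 5 * r^2) * exp (- (sqrt 5 * r))) has_real_derivative
      kappa_deriv2 K s x) (at x)"
    unfolding Matern52
    by (auto intro!: derivative_eq_intros simp: field_simps sqrt_mult_sqrt_left power2_eq_square)
  with Matern52 show ?thesis
    by (simp add: kappa_deriv.simps[abs_def])
qed

text \<open>The derivative is nonpositive on nonnegative arguments. For Matern-3/2 and Matern-5/2 it
  carries a factor \<open>r\<close>, hence the restriction on \<open>x\<close>.\<close>

lemma kappa_antimono:
  assumes "0 \<le> x" "x \<le> y"
  shows "kappa K s y \<le> kappa K s x"
proof (rule DERIV_nonpos_imp_nonincreasing[OF assms(2)])
  fix z
  assume "x \<le> z" "z \<le> y"
  with assms(1) have "kappa_deriv K s z \<le> 0"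
    by (cases K) (auto intro!: mult_nonneg_nonneg)
  then show "\<exists>D. (kappa K s has_real_derivative D) (at z) \<and> D \<le> 0"
    using DERIV_kappa by blast
qed

text \<open>On nonnegative arguments the second derivative changes sign only at the inflection
  point, if there is one. A segment without it in the interior lies on one side of it, so the sign
  is constant there.\<close>

lemma kappa_convex_or_concave:
  assumes "0 \<le> p" "inflection_points K \<inter> {p<..<q} = {}"
  shows "convex_on {p..q} (kappa K s) \<or> concave_on {p..q} (kappa K s)"
proof -
  have "(\<forall>z\<in>{p..q}. kappa_deriv2 K s z \<ge> 0) \<or> (\<forall>z\<in>{p..q}. kappa_deriv2 K s z \<le> 0)"
  proof (cases K)
    case Matern32
    then consider "1 / sqrt 3 \<le> p" | "q \<le> 1 / sqrt 3"
      using assms(2) by fastforce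
    then show ?thesis
    proof cases
      case 1
      then have "sqrt 3 * z - 1 \<ge> 0" if "z \<in> {p..q}" for z
        using order_trans[of "1 / sqrt 3" p z] that by (simp add: field_simps)
      with Matern32 show ?thesis
        by (auto intro!: mult_nonneg_nonneg)
    next
      case 2
      then have "sqrt 3 * z - 1 \<le> 0" if "z \<in> {p..q}" for z
        using order_trans[of z q "1 / sqrt 3"] that by (simp add: field_simps)
      with Matern32 show ?thesis
        by (auto simp: mult_le_0_iff)
    qed
  next
    case Matern52
    \<comment> \<open>The golden ratio, the positive root of \<open>t^2 - t - 1\<close>; the other
      root is \<open>1 - r\<close>.\<close>
    define r where "r = (1 + sqrt 5) / 2"
    have r: "r^2 = r + 1" "r \<ge> 1"
      by (auto simp: r_def power2_eq_square field_simps)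
    have eq: "t^2 - t - 1 = (t - r) * (t + r - 1)" for t
      using r(1) by (simp add: algebra_simps power2_eq_square)
    have "inflection_points K = {r / sqrt 5}"
      by (simp add: Matern52 r_def)
    then consider "r / sqrt 5 \<le> p" | "q \<le> r / sqrt 5"
      using assms(2) by fastforce
    then show ?thesis
    proof cases
      case 1
      then have "(sqrt 5 * z)^2 - sqrt 5 * z - 1 \<ge> 0" if "z \<in> {p..q}" for z
      proof -
        have "r \<le> sqrt 5 * z"
          using order_trans[of "r / sqrt 5" p z] 1 that by (simp add: field_simps)
        with r(2) show ?thesis
          unfolding eq by (intro mult_nonneg_nonneg) auto
      qed
      with Matern52 show ?thesis
        by (auto intro!: mult_nonneg_nonneg)
    next
      case 2
      then have "(sqrt 5 * z)^2 - sqrt 5 * z - 1 \<le> 0" if "z \<in> {p..q}" for z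
      proof -
        have "sqrt 5 * z \<le> r"
          using order_trans[of z q "r / sqrt 5"] 2 that by (simp add: field_simps)
        \<comment> \<open>Here \<open>0 \<le> p\<close> enters: it keeps the factor
          \<open>t + r - 1\<close> nonnegative, to the right of the root
          \<open>1 - r\<close>.\<close>
        moreover have "0 \<le> sqrt 5 * z"
          using that assms(1) by auto
        ultimately show ?thesis
          unfolding eq using r(2) by (intro mult_nonpos_nonneg) auto
      qed
      with Matern52 show ?thesis
        by (auto simp: mult_le_0_iff)
    qed
  qed auto
  then show ?thesis
    using f''_ge0_imp_convex[OF _ DERIV_kappa DERIV_kappa_deriv, of "{p..q}" K s]
      f''_le0_imp_concave[OF _ DERIV_kappa DERIV_kappa_deriv, of "{p..q}" K s]
    by auto
qed

subsection \<open>Distance bounds\<close>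

lemma diag_matrix_mult_vec: "(diag_matrix v *v x) $ j = v $ j * x $ j"
  by (simp add: diag_matrix_def matrix_vector_mult_def mult_delta_left)

lemma matrix_inv_diag_matrix:
  fixes l :: "real ^ 'd::finite"
  assumes "\<forall>j. l $ j \<noteq> 0"
  shows "matrix_inv (diag_matrix l) = diag_matrix (\<chi> j. inverse (l $ j))"
proof -
  have inv: "diag_matrix l ** diag_matrix (\<chi> j. inverse (l $ j)) = mat 1"
      "diag_matrix (\<chi> j. inverse (l $ j)) ** diag_matrix l = mat 1"
    using assms
    by (simp_all add: matrix_eq vec_eq_iff diag_matrix_mult_vec flip: matrix_vector_mul_assoc)
  \<comment> \<open>\<open>matrix_inv\<close> is a choice among two-sided inverses. The explicit
    inverse shows that the choice succeeds, and associativity then identifies the two.\<close>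
  then have "diag_matrix l ** matrix_inv (diag_matrix l) = mat 1"
    unfolding matrix_inv_def by (metis (mono_tags, lifting) someI_ex)
  with inv show ?thesis
    by (metis matrix_mul_assoc matrix_mul_lid matrix_mul_rid)
qed

text \<open>Brings the distance into the coordinatewise form of \<open>zeta_lo\<close> and
  \<open>zeta_up\<close>, so that the bounds can be compared summand by summand.\<close>

lemma scaled_dist_eq:
  assumes "\<forall>j. l $ j > 0"
  shows "scaled_dist l x x' = sqrt (\<Sum>j\<in>UNIV. (x $ j - x' $ j)^2 / (l $ j)^2)"
proof -
  have l: "\<forall>j. l $ j \<noteq> 0"
    using assms by (metis less_irrefl)
  have "(matrix_inv (diag_matrix l) *v (x - x')) $ j = (x $ j - x' $ j) / l $ j" for j
    unfolding matrix_inv_diag_matrix[OF l]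
    by (simp add: diag_matrix_mult_vec divide_inverse mult.commute)
  then show ?thesis
    by (simp add: scaled_dist_def norm_vec_def L2_set_def power_divide)
qed

lemma continuous_on_zeta:
  fixes G :: "('d::finite, 'n::finite) gp"
  shows "continuous_on X (zeta G i)"
proof -
  have "continuous_on X (\<lambda>x. A *v (x - c))" for A :: "real ^ 'd ^ 'd" and c
    by (rule linear_continuous_on_compose[OF _ matrix_vector_mul_linear])
      (intro continuous_intros)
  then have "continuous_on X (\<lambda>x. scaled_dist (ell G) x (inputs G i))"
    unfolding scaled_dist_def by (rule continuous_on_norm)
  then show ?thesis
    unfolding zeta_def[abs_def] profile_arg_def
    by (cases "kern G = RBF") (auto intro: continuous_on_power)
qed

lemma profile_arg_nonneg: "0 \<le> r \<Longrightarrow> 0 \<le> profile_arg K r"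
  by (simp add: profile_arg_def)

lemma profile_arg_mono: "0 \<le> r \<Longrightarrow> r \<le> r' \<Longrightarrow> profile_arg K r \<le> profile_arg K r'"
  by (simp add: profile_arg_def)

lemma profile_arg_strict_mono: "0 \<le> r \<Longrightarrow> r < r' \<Longrightarrow> profile_arg K r < profile_arg K r'"
  by (simp add: profile_arg_def power_strict_mono)

lemma delta_near_nonneg: "0 \<le> delta_near G a b i j"
  by (simp add: delta_near_def infdist_nonneg)

lemma delta_bounds:
  assumes "x \<in> cbox a b"
  shows "delta_near G a b i j \<le> \<bar>x $ j - inputs G i $ j\<bar>"
    and "\<bar>x $ j - inputs G i $ j\<bar> \<le> delta_far G a b i j"
proof -
  have x: "a $ j \<le> x $ j" "x $ j \<le> b $ j"
    using assms by (auto simp: mem_box_cart)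
  then show "delta_near G a b i j \<le> \<bar>x $ j - inputs G i $ j\<bar>"
    unfolding delta_near_def
    using infdist_le[of "x $ j" "{a $ j..b $ j}" "inputs G i $ j"]
    by (simp add: dist_real_def abs_minus_commute)
  show "\<bar>x $ j - inputs G i $ j\<bar> \<le> delta_far G a b i j"
    using x by (auto simp: delta_far_def)
qed

text \<open>Any point is strictly closer to the midpoint of a nondegenerate interval than to the
  farther endpoint, and its distance to the interval is at most that to the midpoint.\<close>

lemma delta_near_less_far:
  assumes "a $ j < b $ j"
  shows "delta_near G a b i j < delta_far G a b i j"
proof -
  define c where "c = inputs G i $ j"
  define m where "m = (a $ j + b $ j) / 2"
  have "delta_near G a b i j \<le> dist c m"
    unfolding delta_near_def c_def using assms by (intro infdist_le) (auto simp: m_def)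
  also have "\<dots> < max \<bar>a $ j - c\<bar> \<bar>b $ j - c\<bar>"
    using assms by (auto simp: dist_real_def m_def abs_if max_def field_simps)
  finally show ?thesis
    by (simp add: delta_far_def c_def)
qed

lemma zeta_lo_nonneg: "0 \<le> zeta_lo G a b i"
  unfolding zeta_lo_def by (intro profile_arg_nonneg real_sqrt_ge_zero sum_nonneg) simp

lemma zeta_bounds:
  assumes "valid_gp G" "x \<in> cbox a b"
  shows "zeta_lo G a b i \<le> zeta G i x" "zeta G i x \<le> zeta_up G a b i"
proof -
  have l: "\<forall>j. ell G $ j > 0"
    using assms(1) by (simp add: valid_gp_def)
  have "(delta_near G a b i j)^2 \<le> (x $ j - inputs G i $ j)^2"
      "(x $ j - inputs G i $ j)^2 \<le> (delta_far G a b i j)^2" for j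
    using delta_bounds[OF assms(2), where G = G and i = i and j = j] delta_near_nonneg[of G a b i j]
    by (auto simp flip: abs_le_square_iff)
  then show "zeta_lo G a b i \<le> zeta G i x" "zeta G i x \<le> zeta_up G a b i"
    unfolding zeta_lo_def zeta_up_def zeta_def scaled_dist_eq[OF l]
    by (auto intro!: profile_arg_mono real_sqrt_le_mono sum_mono divide_right_mono sum_nonneg)
qed

text \<open>Rules out \<open>S = 0\<close> for admissible breakpoints, so every argument arising in
  the box lies in some segment and the \<open>Min\<close> and \<open>Max\<close> of the envelopes
  run over nonempty sets.\<close>

lemma zeta_lo_less_up:
  assumes "valid_gp G" "\<forall>j. a $ j < b $ j"
  shows "zeta_lo G a b i < zeta_up G a b i"
  unfolding zeta_lo_def zeta_up_def
proof (intro profile_arg_strict_mono real_sqrt_less_mono sum_strict_mono)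
  fix j
  have "ell G $ j > 0"
    using assms(1) by (simp add: valid_gp_def)
  moreover have "(delta_near G a b i j)^2 < (delta_far G a b i j)^2"
    using delta_near_less_far[of a j b G i] assms(2) delta_near_nonneg
    by (intro power_strict_mono) auto
  ultimately show "(delta_near G a b i j)^2 / (ell G $ j)^2 < (delta_far G a b i j)^2 / (ell G $ j)^2"
    by (simp add: divide_strict_right_mono)
qed (auto intro!: sum_nonneg)

subsection \<open>Piecewise envelopes\<close>

lemma segs_nonempty:
  assumes "\<eta> 0 \<le> z" "z \<le> \<eta> S" "0 < S"
  shows "segs S \<eta> z \<noteq> {}"
proof -
  \<comment> \<open>The first breakpoint of positive index at or above \<open>z\<close> closes the
    segment: its predecessor is either \<open>\<eta> 0\<close> or fails the property by minimality.
    Positivity of \<open>s\<close> keeps \<open>s - 1\<close> from being truncated.\<close>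
  define s where "s = (LEAST s. 0 < s \<and> z \<le> \<eta> s)"
  have s: "0 < s \<and> z \<le> \<eta> s"
    unfolding s_def using assms(2,3) by (intro LeastI) auto
  moreover have "s \<le> S"
    unfolding s_def using assms(2,3) by (intro Least_le) auto
  moreover have "\<eta> (s - 1) \<le> z"
  proof (cases "s = 1")
    case False
    then have "0 < s - 1" "s - 1 < s"
      using s by auto
    then show ?thesis
      using not_less_Least[of "s - 1" "\<lambda>s. 0 < s \<and> z \<le> \<eta> s"] by (auto simp flip: s_def)
  qed (use assms(1) in simp)
  ultimately show ?thesis
    by (auto simp: segs_def)
qed

lemma finite_segs: "finite (segs S \<eta> z)"
  by (simp add: segs_def)

lemma admissible_segs_nonempty:
  assumes "valid_gp G" "\<forall>j. a $ j < b $ j" "x \<in> cbox a b" "admissible_breakpoints G a b i S \<eta>"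
  shows "segs S \<eta> (zeta G i x) \<noteq> {}"
proof (rule segs_nonempty)
  show "0 < S"
    using assms(4) zeta_lo_less_up[OF assms(1,2), of i]
    by (cases "S = 0") (auto simp: admissible_breakpoints_def)
qed (use assms zeta_bounds in \<open>auto simp: admissible_breakpoints_def\<close>)

text \<open>An inflection point strictly inside a segment would lie strictly inside the whole range
  and so be some \<open>\<eta> m\<close>; strict monotonicity then forces
  \<open>s - 1 < m < s\<close>, impossible for naturals.\<close>

lemma admissible_segment:
  assumes "admissible_breakpoints G a b i S \<eta>" "s \<in> {1..S}"
  shows "0 \<le> \<eta> (s - 1)" "inflection_points (kern G) \<inter> {\<eta> (s - 1)<..<\<eta> s} = {}"
proof -
  have mono: "strict_mono_on {0..S} \<eta>"
    and ends: "\<eta> 0 = zeta_lo G a b i" "\<eta> S = zeta_up G a b i"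
    and infl: "inflection_points (kern G) \<inter> {zeta_lo G a b i<..<zeta_up G a b i} \<subseteq> \<eta> ` {0..S}"
    using assms(1) by (auto simp: admissible_breakpoints_def)
  have lo: "zeta_lo G a b i \<le> \<eta> (s - 1)" and up: "\<eta> s \<le> zeta_up G a b i"
    using assms(2) strict_mono_on_leD[OF mono, of 0 "s - 1"] strict_mono_on_leD[OF mono, of s S]
    by (auto simp flip: ends)
  show "0 \<le> \<eta> (s - 1)"
    using lo zeta_lo_nonneg[of G a b i] by linarith
  show "inflection_points (kern G) \<inter> {\<eta> (s - 1)<..<\<eta> s} = {}"
  proof (rule ccontr)
    assume "\<not> ?thesis"
    then obtain c where c: "c \<in> inflection_points (kern G)" "\<eta> (s - 1) < c" "c < \<eta> s"
      by auto
    then obtain m where m: "m \<le> S" "c = \<eta> m"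
      using infl lo up by fastforce
    have "s - 1 < m" "m < s"
      using c m assms(2) strict_mono_on_less[OF mono, of "s - 1" m] strict_mono_on_less[OF mono, of m s]
      by auto
    then show False
      by simp
  qed
qed

text \<open>\<open>Min\<close> is below and \<open>Max\<close> above the value on each active
  segment, so enclosure on a single segment containing the argument is enough.\<close>

lemma pw_bounds:
  assumes "valid_gp G" "\<forall>j. a $ j < b $ j" "x \<in> cbox a b"
    and adm: "admissible_breakpoints G a b i (S i) (\<eta> i)"
  shows "pw_lower G S \<eta> i x \<le> k_at G i x" "k_at G i x \<le> pw_upper G S \<eta> i x"
proof -
  obtain s where s: "s \<in> segs (S i) (\<eta> i) (zeta G i x)"
    using admissible_segs_nonempty[OF assms] by blast
  then have s': "s \<in> {1..S i}" "zeta G i x \<in> {\<eta> i (s - 1)..\<eta> i s}"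
    by (auto simp: segs_def)
  have "prof G field_differentiable at z" for z
    using DERIV_kappa field_differentiable_def by blast
  note bounds = seg_bounds[OF kappa_convex_or_concave[OF admissible_segment[OF adm s'(1)]] s'(2) this]
  have "pw_lower G S \<eta> i x \<le> seg_lower (prof G) (\<eta> i (s - 1)) (\<eta> i s) (zeta G i x)"
    unfolding pw_lower_def using s by (intro Min_le) (auto simp: finite_segs)
  then show "pw_lower G S \<eta> i x \<le> k_at G i x"
    using bounds(1) unfolding k_at_def by (rule order_trans)
  have "seg_upper (prof G) (\<eta> i (s - 1)) (\<eta> i s) (zeta G i x) \<le> pw_upper G S \<eta> i x"
    unfolding pw_upper_def using s by (intro Max_ge) (auto simp: finite_segs)
  then show "k_at G i x \<le> pw_upper G S \<eta> i x"
    using bounds(2) unfolding k_at_def by (rule order_trans[rotated])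
qed

text \<open>The sets of points whose argument falls in a given segment are closed, being preimages
  of closed intervals under the continuous \<open>zeta\<close>. The family \<open>g\<close> is left
  general to serve both the lower envelope and the negated upper one.\<close>

lemma lsc_on_Min_segs:
  assumes "valid_gp G" "\<forall>j. a $ j < b $ j" "admissible_breakpoints G a b i S \<eta>"
    and cont: "\<And>s. continuous_on UNIV (g s)"
  shows "lsc_on (cbox a b) (\<lambda>x. Min ((\<lambda>s. g s (zeta G i x)) ` segs S \<eta> (zeta G i x)))"
proof -
  define C where "C s = {x. \<eta> (s - 1) \<le> zeta G i x \<and> zeta G i x \<le> \<eta> s}" for s
  have segs: "segs S \<eta> (zeta G i x) = {s \<in> {1..S}. x \<in> C s}" for x
    by (auto simp: segs_def C_def)
  show ?thesis
    unfolding segs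
  proof (rule lsc_on_Min)
    show "closed (C s)" for s
      unfolding C_def by (intro closed_Collect_conj closed_Collect_le continuous_on_zeta continuous_on_const)
    show "continuous_on (cbox a b) (\<lambda>x. g s (zeta G i x))" for s
      using continuous_on_compose2[OF cont continuous_on_zeta] by blast
    show "\<exists>s\<in>{1..S}. x \<in> C s" if "x \<in> cbox a b" for x
      using admissible_segs_nonempty[OF assms(1,2) that assms(3)] unfolding segs by blast
  qed simp
qed

lemma lsc_on_pw_lower:
  assumes "valid_gp G" "\<forall>j. a $ j < b $ j" "admissible_breakpoints G a b i (S i) (\<eta> i)"
  shows "lsc_on (cbox a b) (pw_lower G S \<eta> i)"
  unfolding pw_lower_def[abs_def]
  using assms by (rule lsc_on_Min_segs) (rule continuous_on_seg_lower)

lemma lsc_on_uminus_pw_upper: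
  assumes "valid_gp G" "\<forall>j. a $ j < b $ j" "admissible_breakpoints G a b i (S i) (\<eta> i)"
  shows "lsc_on (cbox a b) (\<lambda>x. - pw_upper G S \<eta> i x)"
proof -
  let ?u = "\<lambda>s z. - seg_upper (prof G) (\<eta> i (s - 1)) (\<eta> i s) z"
  have "lsc_on (cbox a b) (\<lambda>x. Min ((\<lambda>s. ?u s (zeta G i x)) ` segs (S i) (\<eta> i) (zeta G i x)))"
    using assms by (rule lsc_on_Min_segs) (intro continuous_on_minus continuous_on_seg_upper)
  \<comment> \<open>Negation turns \<open>Max\<close> into \<open>Min\<close> when some segment is
    active, which is known for points of the box.\<close>
  moreover have "- pw_upper G S \<eta> i x
      = Min ((\<lambda>s. ?u s (zeta G i x)) ` segs (S i) (\<eta> i) (zeta G i x))" if "x \<in> cbox a b" for x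
    using admissible_segs_nonempty[OF assms(1,2) that assms(3)]
    unfolding pw_upper_def by (subst minus_Max_eq_Min) (auto simp: finite_segs image_image)
  ultimately show ?thesis
    by (subst lsc_on_cong)
qed

section \<open>From envelopes of single terms to the node bound\<close>

lemma attains_min_imp_INF:
  assumes "attains_min f X"
  obtains x where "x \<in> X" "(INF y\<in>X. f y) = f x" "\<And>y. y \<in> X \<Longrightarrow> f x \<le> f y"
proof -
  from assms obtain x where x: "x \<in> X" "\<And>y. y \<in> X \<Longrightarrow> f x \<le> f y"
    unfolding attains_min_def by blast
  then have "(INF y\<in>X. f y) = f x"
    by (intro cInf_eq_minimum) auto
  with x that show thesis
    by blast
qed

lemma continuous_on_posterior_mean: "continuous_on X (posterior_mean G)"
proof -
  have "continuous_on UNIV (prof G)"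
    by (meson DERIV_kappa DERIV_isCont continuous_at_imp_continuous_on)
  then have "continuous_on X (k_at G i)" for i
    unfolding k_at_def[abs_def] by (rule continuous_on_compose2[OF _ continuous_on_zeta]) simp
  then show ?thesis
    unfolding posterior_mean_def[abs_def] by (intro continuous_intros)
qed

text \<open>With nonnegative weights on both products, a lower bound for \<open>k\<close> in the
  first and an upper bound in the second yield a lower bound for the term.\<close>

lemma alpha_split: "alpha G $ i * k = alpha_pos G i * k - alpha_neg G i * k"
  by (auto simp: alpha_pos_def alpha_neg_def max_def)

lemma alpha_pos_nonneg: "0 \<le> alpha_pos G i" and alpha_neg_nonneg: "0 \<le> alpha_neg G i"
  by (simp_all add: alpha_pos_def alpha_neg_def)

lemma palm_mean_le_posterior_mean:
  assumes "valid_gp G" "\<forall>j. a $ j < b $ j" "x \<in> cbox a b"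
    and "\<forall>i\<in>important G \<rho> a b. admissible_breakpoints G a b i (S i) (\<eta> i)"
  shows "palm_mean G \<rho> S \<eta> a b x \<le> posterior_mean G x"
proof -
  have "analytic_term G a b i \<le> alpha G $ i * k_at G i x" for i
    unfolding analytic_term_def alpha_split k_at_def
    using zeta_bounds[OF assms(1,3), of i] zeta_lo_nonneg[of G a b i]
    by (intro diff_mono mult_left_mono kappa_antimono alpha_pos_nonneg alpha_neg_nonneg) auto
  moreover have "alpha_pos G i * pw_lower G S \<eta> i x - alpha_neg G i * pw_upper G S \<eta> i x
      \<le> alpha G $ i * k_at G i x" if "i \<in> important G \<rho> a b" for i
    unfolding alpha_split using pw_bounds[OF assms(1-3)] that assms(4)
    by (intro diff_mono mult_left_mono alpha_pos_nonneg alpha_neg_nonneg) auto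
  ultimately have "palm_mean G \<rho> S \<eta> a b x
      \<le> (\<Sum>i\<in>important G \<rho> a b. alpha G $ i * k_at G i x)
        + (\<Sum>i\<in>unimportant G \<rho> a b. alpha G $ i * k_at G i x)"
    unfolding palm_mean_def by (intro add_mono sum_mono) auto
  also have "\<dots> = posterior_mean G x"
    unfolding posterior_mean_def unimportant_def by (subst sum.subset_diff[of "important G \<rho> a b" UNIV]) auto
  finally show ?thesis .
qed

lemma lsc_on_palm_mean:
  assumes "valid_gp G" "\<forall>j. a $ j < b $ j"
    and "\<forall>i\<in>important G \<rho> a b. admissible_breakpoints G a b i (S i) (\<eta> i)"
  shows "lsc_on (cbox a b) (palm_mean G \<rho> S \<eta> a b)"
proof -
  \<comment> \<open>The subtraction is written as a nonnegative multiple of the negated upper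
    envelope, since lower semicontinuity survives only nonnegative scaling.\<close>
  have "lsc_on (cbox a b) (\<lambda>x. (\<Sum>i\<in>important G \<rho> a b.
      alpha_pos G i * pw_lower G S \<eta> i x + alpha_neg G i * (- pw_upper G S \<eta> i x))
      + (\<Sum>i\<in>unimportant G \<rho> a b. analytic_term G a b i))"
    using assms
    by (intro lsc_on_add lsc_on_sum lsc_on_cmult lsc_on_pw_lower lsc_on_uminus_pw_upper
        alpha_pos_nonneg alpha_neg_nonneg continuous_on_imp_lsc_on continuous_on_const) auto
  then show ?thesis
    by (simp add: palm_mean_def[abs_def])
qed

theorem proposition3:
  fixes G :: "('d::finite, 'n::finite) gp"
    and \<rho> :: real
    and XL XU a b :: "real ^ 'd"
    and S :: "'n \<Rightarrow> nat"
    and \<eta> :: "'n \<Rightarrow> nat \<Rightarrow> real"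
  assumes "valid_gp G"
    and "0 \<le> \<rho>" and "\<rho> \<le> 1"
    and "\<forall>j. XL $ j < XU $ j"
    and "\<forall>j. a $ j < b $ j"
    and "cbox a b \<subseteq> cbox XL XU"
    and "\<forall>i\<in>important G \<rho> a b. admissible_breakpoints G a b i (S i) (\<eta> i)"
  shows "attains_min (palm_mean G \<rho> S \<eta> a b) (cbox a b)
       \<and> attains_min (posterior_mean G) (cbox a b)
       \<and> valid_lower_bound G a b (palm_lb G \<rho> S \<eta> a b)"
proof (intro conjI)
  have box: "compact (cbox a b)" "cbox a b \<noteq> {}"
    using assms(5) by (auto simp: interval_ne_empty_cart less_imp_le)
  show palm: "attains_min (palm_mean G \<rho> S \<eta> a b) (cbox a b)"
    using lsc_on_attains_min[OF box lsc_on_palm_mean] assms(1,5,7) by blast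
  show mean: "attains_min (posterior_mean G) (cbox a b)"
    using lsc_on_attains_min[OF box continuous_on_imp_lsc_on] continuous_on_posterior_mean by blast
  \<comment> \<open>With \<open>x\<close> minimizing the estimator and \<open>y\<close> the mean,
    the bound is the chain: estimator at \<open>x\<close>, at most estimator at \<open>y\<close>, at
    most mean at \<open>y\<close>. Attainment is what lets both infima be replaced by these
    values.\<close>
  obtain x where x: "palm_lb G \<rho> S \<eta> a b = palm_mean G \<rho> S \<eta> a b x"
      "\<And>y. y \<in> cbox a b \<Longrightarrow> palm_mean G \<rho> S \<eta> a b x \<le> palm_mean G \<rho> S \<eta> a b y"
    using attains_min_imp_INF[OF palm] unfolding palm_lb_def by metis
  obtain y where y: "y \<in> cbox a b" "(INF x\<in>cbox a b. posterior_mean G x) = posterior_mean G y"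
    using attains_min_imp_INF[OF mean] by metis
  show "valid_lower_bound G a b (palm_lb G \<rho> S \<eta> a b)"
    unfolding valid_lower_bound_def x(1) y(2)
    using x(2)[OF y(1)] palm_mean_le_posterior_mean[OF assms(1,5) y(1) assms(7)]
    by (rule order_trans)
qed

end
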